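(* For every constant $c>0$, there exists a full-compatibility instance of the online allocation model with a common nonnegative, nondecreasing, discrete-concave bonus function $f$ (i.e. $f_i=f$ for all products $i$) such that the LP-based independent-rounding policy obtained from an optimal solution of the LP relaxation satisfies $$\mathbb E[\mathrm{Rev}^{\mathrm{LP}}]<c\,\mathrm{OPT}_{\mathrm{on}}.$$
   Context: Model. An instance consists of products $\mathcal I=\{1,\dots,m\}$, capacities $b_i\in\mathbb Z_+$, base rewards $r_i\ge 0$, bonus functions $f_i:\mathbb Z_+\to\mathbb R_+$ that are nonnegative and nondecreasing with $f_i(0)=0$, a horizon of $T$ periods and arrival probabilities $p_1,\dots,p_T\in[0,1]$. In period $t$ a customer arrives with probability $p_t$, independently across periods; $L$ is the total number of arrivals and $\mu_L=\sum_{t=1}^T p_t$ its mean. Each arriving customer must be immediately and irrevocably assigned to a product with remaining capacity or rejected; every customer may be assigned to every product (full compatibility). The $k$-th sale of product $i$ yields reward $r_i+f_i(k)$. An online algorithm $\pi$ knows all parameters of the instance, but its decision in each period depends only on the arrivals observed so far, its past decisions and internal randomization independent of the arrivals. $\mathrm{Rev}^\pi$ is its random total reward and $\mathrm{OPT}_{\mathrm{on}}=\sup_\pi\mathbb E[\mathrm{Rev}^\pi]$ over all online algorithms. Discrete concavity of $f$: $f(k+1)-f(k)\le f(k)-f(k-1)$ for all $k\ge1$ in the relevant range (up to capacity). LP relaxation: maximize $\sum_{i\in\mathcal I}\sum_{k=1}^{b_i}(r_i+f_i(k))\,y_{i,k}$ subject to $\sum_{i\in\mathcal I}\sum_{k=1}^{b_i}y_{i,k}\le\mu_L$;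 $y_{i,k}\le y_{i,k-1}$ for all $i\in\mathcal I$, $k=2,\dots,b_i$; $0\le y_{i,k}\le1$ for all $i\in\mathcal I$, $k=1,\dots,b_i$. LP-based independent rounding: given an optimal solution $\boldsymbol y^*$ of this LP, set $q_i=\frac1{\mu_L}\sum_{k=1}^{b_i}y^*_{i,k}$. Each arriving customer is independently assigned to product $i$ with probability $q_i$, with any remaining probability assigned to rejection; a customer directed to a product with no remaining capacity is rejected. *)

theory Defs
  imports "HOL-Probability.Probability"
begin

text \<open>
  Products are indexed by \<open>{1..products I}\<close> and periods by \<open>{1..horizon I}\<close>; the fields are
  irrelevant outside these ranges.  Full compatibility is built in: no product is ever excluded
  for a customer except by exhausted capacity.
\<close>

record alloc =
  products :: nat
  capacity :: "nat \<Rightarrow> nat"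
  base_reward :: "nat \<Rightarrow> real"
  bonus :: "nat \<Rightarrow> nat \<Rightarrow> real"
  horizon :: nat
  arrival_prob :: "nat \<Rightarrow> real"

definition valid_instance :: "alloc \<Rightarrow> bool" where
  "valid_instance I \<longleftrightarrow>
     (\<forall>i\<in>{1..products I}. base_reward I i \<ge> 0 \<and>
        (\<forall>k. bonus I i k \<ge> 0) \<and> mono (bonus I i) \<and> bonus I i 0 = 0) \<and>
     (\<forall>t\<in>{1..horizon I}. 0 \<le> arrival_prob I t \<and> arrival_prob I t \<le> 1)"

definition discrete_concave_upto :: "nat \<Rightarrow> (nat \<Rightarrow> real) \<Rightarrow> bool" where
  "discrete_concave_upto n f \<longleftrightarrow>
     (\<forall>k\<ge>1. k + 1 \<le> n \<longrightarrow> f (k + 1) - f k \<le> f k - f (k - 1))"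

definition mean_arrivals :: "alloc \<Rightarrow> real" where
  "mean_arrivals I = (\<Sum>t = 1..horizon I. arrival_prob I t)"


text \<open>
  A history lists, for each elapsed period, whether a customer arrived and the product sold
  (\<open>None\<close>: no arrival, or rejection).
\<close>

type_synonym history = "(bool \<times> nat option) list"

definition sales :: "history \<Rightarrow> nat \<Rightarrow> nat" where
  "sales h i = count_list (map snd h) (Some i)"

definition reward :: "alloc \<Rightarrow> history \<Rightarrow> real" where
  "reward I h = (\<Sum>i = 1..products I. \<Sum>k = 1..sales h i. base_reward I i + bonus I i k)"

text \<open>
  A policy gives the distribution of the decision for a customer arriving right after the given
  history.  An online algorithm first draws a policy, so its internal randomization may be
  correlated across periods as well as fresh in each period.  Discrete distributions lose no
  generality, because up to the horizon there are only finitely many histories and feasible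
  decisions.
\<close>

type_synonym policy = "history \<Rightarrow> nat option pmf"

definition feasible_policy :: "alloc \<Rightarrow> policy \<Rightarrow> bool" where
  "feasible_policy I \<pi> \<longleftrightarrow>
     (\<forall>h i. Some i \<in> set_pmf (\<pi> h) \<longrightarrow> i \<in> {1..products I} \<and> sales h i < capacity I i)"

definition online_algorithm :: "alloc \<Rightarrow> policy pmf \<Rightarrow> bool" where
  "online_algorithm I A \<longleftrightarrow> (\<forall>\<pi>\<in>set_pmf A. feasible_policy I \<pi>)"

text \<open>
  Joint law of arrivals and decisions over the first \<open>t\<close> periods.  The arrival in each period is
  drawn independently of the history.
\<close>

primrec trajectory :: "alloc \<Rightarrow> policy \<Rightarrow> nat \<Rightarrow> history pmf" where
  "trajectory I \<pi> 0 = return_pmf []"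
| "trajectory I \<pi> (Suc t) =
     bind_pmf (trajectory I \<pi> t) (\<lambda>h.
       bind_pmf (bernoulli_pmf (arrival_prob I (Suc t))) (\<lambda>a.
         map_pmf (\<lambda>d. h @ [(a, d)]) (if a then \<pi> h else return_pmf None)))"

definition expected_reward :: "alloc \<Rightarrow> policy pmf \<Rightarrow> real" where
  "expected_reward I A =
     measure_pmf.expectation (bind_pmf A (\<lambda>\<pi>. trajectory I \<pi> (horizon I))) (reward I)"

definition opt_online :: "alloc \<Rightarrow> real" where
  "opt_online I = (SUP A\<in>{A. online_algorithm I A}. expected_reward I A)"


definition lp_feasible :: "alloc \<Rightarrow> (nat \<Rightarrow> nat \<Rightarrow> real) \<Rightarrow> bool" where
  "lp_feasible I y \<longleftrightarrow>
     (\<Sum>i = 1..products I. \<Sum>k = 1..capacity I i. y i k) \<le> mean_arrivals I \<and>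
     (\<forall>i\<in>{1..products I}. \<forall>k\<in>{2..capacity I i}. y i k \<le> y i (k - 1)) \<and>
     (\<forall>i\<in>{1..products I}. \<forall>k\<in>{1..capacity I i}. 0 \<le> y i k \<and> y i k \<le> 1)"

definition lp_value :: "alloc \<Rightarrow> (nat \<Rightarrow> nat \<Rightarrow> real) \<Rightarrow> real" where
  "lp_value I y =
     (\<Sum>i = 1..products I. \<Sum>k = 1..capacity I i. (base_reward I i + bonus I i k) * y i k)"

definition lp_optimal :: "alloc \<Rightarrow> (nat \<Rightarrow> nat \<Rightarrow> real) \<Rightarrow> bool" where
  "lp_optimal I y \<longleftrightarrow> lp_feasible I y \<and> (\<forall>z. lp_feasible I z \<longrightarrow> lp_value I z \<le> lp_value I y)"

definition rounding_prob :: "alloc \<Rightarrow> (nat \<Rightarrow> nat \<Rightarrow> real) \<Rightarrow> nat \<Rightarrow> real" where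
  "rounding_prob I y i = (\<Sum>k = 1..capacity I i. y i k) / mean_arrivals I"

definition rounding_mass :: "alloc \<Rightarrow> (nat \<Rightarrow> nat \<Rightarrow> real) \<Rightarrow> nat option \<Rightarrow> real" where
  "rounding_mass I y d =
     (case d of
        Some i \<Rightarrow> (if i \<in> {1..products I} then rounding_prob I y i else 0)
      | None \<Rightarrow> 1 - (\<Sum>i = 1..products I. rounding_prob I y i))"

definition rounding_pmf :: "alloc \<Rightarrow> (nat \<Rightarrow> nat \<Rightarrow> real) \<Rightarrow> nat option pmf" where
  "rounding_pmf I y = embed_pmf (rounding_mass I y)"

definition lp_rounding_policy :: "alloc \<Rightarrow> (nat \<Rightarrow> nat \<Rightarrow> real) \<Rightarrow> policy" where
  "lp_rounding_policy I y h =
     map_pmf (\<lambda>d. case d of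
                    Some i \<Rightarrow> (if sales h i < capacity I i then Some i else None)
                  | None \<Rightarrow> None)
       (rounding_pmf I y)"


text \<open>LP feasibility makes the masses above a probability distribution.\<close>

lemma pmf_rounding_pmf:
  assumes "valid_instance I" "lp_feasible I y"
  shows "pmf (rounding_pmf I y) d = rounding_mass I y d"
proof -
  let ?S = "insert None (Some ` {1..products I})"
  have mu: "mean_arrivals I \<ge> 0"
    using assms(1) unfolding mean_arrivals_def valid_instance_def by (auto intro!: sum_nonneg)
  have q: "rounding_prob I y i \<ge> 0" if "i \<in> {1..products I}" for i
    using assms(2) that mu unfolding rounding_prob_def lp_feasible_def
    by (auto intro!: divide_nonneg_nonneg sum_nonneg)
  have "(\<Sum>i = 1..products I. rounding_prob I y i) \<le> 1"
  proof (cases "mean_arrivals I = 0")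
    case False
    with mu have "mean_arrivals I > 0" by simp
    with assms(2) show ?thesis
      by (simp add: rounding_prob_def lp_feasible_def flip: sum_divide_distrib)
  qed (simp add: rounding_prob_def)
  with q have nonneg: "rounding_mass I y d \<ge> 0" for d
    by (auto simp: rounding_mass_def split: option.split)
  have "(\<Sum>d\<in>?S. rounding_mass I y d) = 1"
    by (subst sum.insert) (auto simp: sum.reindex rounding_mass_def)
  moreover have "(\<integral>\<^sup>+ d. ennreal (rounding_mass I y d) \<partial>count_space UNIV)
      = (\<Sum>d\<in>?S. ennreal (rounding_mass I y d))"
    by (rule nn_integral_count_space'[where A = ?S])
       (auto simp: rounding_mass_def image_iff split: option.splits)
  ultimately have "(\<integral>\<^sup>+ d. ennreal (rounding_mass I y d) \<partial>count_space UNIV) = 1"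
    by (simp add: nonneg sum_ennreal)
  with nonneg show ?thesis
    unfolding rounding_pmf_def by (intro pmf_embed_pmf) auto
qed

lemma feasible_lp_rounding_policy:
  assumes "valid_instance I" "lp_feasible I y"
  shows "feasible_policy I (lp_rounding_policy I y)"
  using assms
  by (auto simp: feasible_policy_def lp_rounding_policy_def set_pmf_iff pmf_rounding_pmf
        rounding_mass_def split: option.splits if_splits)


text \<open>The supremum defining \<open>opt_online\<close> is over a nonempty set of reals that is bounded above.\<close>

lemma sales_le_capacity:
  assumes "feasible_policy I \<pi>" "h \<in> set_pmf (trajectory I \<pi> t)"
  shows "sales h i \<le> capacity I i"
  using assms(2)
proof (induction t arbitrary: h)
  case (Suc t)
  then obtain g a d where g: "g \<in> set_pmf (trajectory I \<pi> t)" "h = g @ [(a, d)]"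
    and d: "d \<in> set_pmf (if a then \<pi> g else return_pmf None)"
    by auto
  have "sales g i \<le> capacity I i" using Suc.IH g(1) .
  moreover have "sales g i < capacity I i" if "d = Some i"
    using assms(1) d that unfolding feasible_policy_def by (auto split: if_splits)
  ultimately show ?case
    by (auto simp: g(2) sales_def)
qed (simp add: sales_def)

lemma opt_online_wf:
  assumes "valid_instance I"
  shows "{A. online_algorithm I A} \<noteq> {}"
    and "bdd_above (expected_reward I ` {A. online_algorithm I A})"
proof -
  have "online_algorithm I (return_pmf (\<lambda>_. return_pmf None))"
    by (simp add: online_algorithm_def feasible_policy_def)
  thus "{A. online_algorithm I A} \<noteq> {}" by blast
next
  let ?B = "\<Sum>i = 1..products I. \<Sum>k = 1..capacity I i. base_reward I i + bonus I i k"
  have nn: "base_reward I i + bonus I i k \<ge> 0" if "i \<in> {1..products I}" for i k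
    using assms that by (auto simp: valid_instance_def)
  have "expected_reward I A \<le> ?B" if "online_algorithm I A" for A
  proof -
    let ?M = "bind_pmf A (\<lambda>\<pi>. trajectory I \<pi> (horizon I))"
    have "0 \<le> reward I h \<and> reward I h \<le> ?B" if h: "h \<in> set_pmf ?M" for h
    proof -
      have sub: "{1..sales h i} \<subseteq> {1..capacity I i}" for i
      proof -
        obtain \<pi> where "\<pi> \<in> set_pmf A" "h \<in> set_pmf (trajectory I \<pi> (horizon I))"
          using h by auto
        with \<open>online_algorithm I A\<close> have "sales h i \<le> capacity I i"
          by (intro sales_le_capacity) (auto simp: online_algorithm_def)
        thus ?thesis by auto
      qed
      have "reward I h \<le> ?B"
        unfolding reward_def using nn by (intro sum_mono sum_mono2[OF _ sub]) auto
      moreover have "0 \<le> reward I h"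
        unfolding reward_def using nn by (intro sum_nonneg) auto
      ultimately show ?thesis by simp
    qed
    hence ae: "AE h in measure_pmf ?M. 0 \<le> reward I h \<and> reward I h \<le> ?B"
      by (simp add: AE_measure_pmf_iff)
    have "integrable (measure_pmf ?M) (reward I)"
      by (rule measure_pmf.integrable_const_bound[where B = ?B]) (use ae in auto)
    thus ?thesis
      unfolding expected_reward_def
      by (intro measure_pmf.integral_le_const) (use ae in auto)
  qed
  thus "bdd_above (expected_reward I ` {A. online_algorithm I A})"
    by (intro bdd_aboveI2[where M = ?B]) simp
qed

end

theory Submission
  imports Defs
begin

text \<open>
  One customer arrives for sure, and \<open>f k = k\<close>.  Product 1 has a single unit with base reward
  \<open>N\<close>; product 2 has base reward 0 and \<open>2 * N + 2\<close> units.  The LP may split the single customer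
  evenly over all units of product 2, and so values product 2 at its average reward
  \<open>N + 3/2\<close>, more than the \<open>N + 1\<close> earned by product 1.  But the only sale ever made of product 2
  is its first, which earns 1.
\<close>

definition gap_instance :: "nat \<Rightarrow> alloc" where
  "gap_instance N =
     \<lparr>products = 2,
      capacity = (\<lambda>i. if i = 1 then 1 else 2 * N + 2),
      base_reward = (\<lambda>i. if i = 1 then real N else 0),
      bonus = (\<lambda>_. real),
      horizon = 1,
      arrival_prob = (\<lambda>_. 1)\<rparr>"

lemma gap_instance_simps [simp]:
  "products (gap_instance N) = 2"
  "capacity (gap_instance N) i = (if i = 1 then 1 else 2 * N + 2)"
  "base_reward (gap_instance N) i = (if i = 1 then real N else 0)"
  "bonus (gap_instance N) i = real"
  "horizon (gap_instance N) = 1"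
  "arrival_prob (gap_instance N) t = 1"
  "mean_arrivals (gap_instance N) = 1"
  by (simp_all add: gap_instance_def mean_arrivals_def)

lemma atLeastAtMost_1_2: "{Suc 0..2} = {1, 2}"
  by auto

lemma valid_gap_instance: "valid_instance (gap_instance N)"
  by (auto simp: valid_instance_def mono_def)

text \<open>Chebyshev's sum inequality: the weights \<open>k\<close> increase while \<open>y\<close>
  decreases, so the weighted sum is at most the mean weight \<open>(n + 1) / 2\<close> times the
  total mass.\<close>

lemma weighted_sum_antimono_le:
  fixes y :: "nat \<Rightarrow> real"
  assumes "\<forall>k\<in>{2..n}. y k \<le> y (k - 1)"
  shows "(\<Sum>k = 1..n. real k * y k) \<le> (real n + 1) / 2 * (\<Sum>k = 1..n. y k)"
proof (cases "n = 0")
  case False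
  have anti: "y (Suc j) \<le> y (Suc i)" if "i \<le> j" "j < n" for i j
    using that
  proof (induction j rule: dec_induct)
    case (step j)
    have "y (Suc (Suc j)) \<le> y (Suc j)"
      using assms step.prems by (auto dest: bspec[where x = "Suc (Suc j)"])
    with step show ?case by simp
  qed simp
  \<comment> \<open>Chebyshev's inequality is stated over \<open>{0..<n}\<close>, hence the
    reindexing by \<open>Suc\<close>.\<close>
  have shift: "(\<Sum>k = 1..n. g k) = (\<Sum>k = 0..<n. g (Suc k))" for g :: "nat \<Rightarrow> real"
    by (simp add: sum.atLeast1_atMost_eq atLeast0LessThan)
  have sum_Suc: "(\<Sum>k = 0..<n. real (Suc k)) = real n * (real n + 1) / 2"
    by (induction n) (simp_all add: field_simps)
  have "real n * (\<Sum>k = 0..<n. real (Suc k) * y (Suc k))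
      \<le> (\<Sum>k = 0..<n. real (Suc k)) * (\<Sum>k = 0..<n. y (Suc k))"
    using Chebyshev_sum_upper[of n "\<lambda>k. real (Suc k)" "\<lambda>k. y (Suc k)"] anti by simp
  hence "real n * (\<Sum>k = 1..n. real k * y k)
      \<le> real n * ((real n + 1) / 2 * (\<Sum>k = 1..n. y k))"
    unfolding shift sum_Suc
    by (simp only: times_divide_eq_left times_divide_eq_right mult.assoc)
  with False show ?thesis by simp
qed simp

text \<open>The monotonicity constraint keeps the mass of product 2 from concentrating on its late,
  well-paid units, so each unit of mass there earns at most the average reward.\<close>

lemma lp_value_gap_instance_le:
  assumes "lp_feasible (gap_instance N) y"
  shows "lp_value (gap_instance N) y
    \<le> (real N + 1) * y 1 1 + (real N + 3 / 2) * (\<Sum>k = 1..2 * N + 2. y 2 k)"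
proof -
  have "(\<Sum>k = 1..2 * N + 2. real k * y 2 k)
      \<le> (real (2 * N + 2) + 1) / 2 * (\<Sum>k = 1..2 * N + 2. y 2 k)"
    using assms by (intro weighted_sum_antimono_le) (simp add: lp_feasible_def)
  also have "(real (2 * N + 2) + 1) / 2 = real N + 3 / 2"
    by (simp add: field_simps)
  finally show ?thesis
    by (simp add: lp_value_def atLeastAtMost_1_2 del: sum.cl_ivl_Suc)
qed

lemma lp_feasible_gap_instanceD:
  assumes "lp_feasible (gap_instance N) y"
  shows "0 \<le> y 1 1" "y 1 1 + (\<Sum>k = 1..2 * N + 2. y 2 k) \<le> 1"
  using assms by (simp_all add: lp_feasible_def atLeastAtMost_1_2 del: sum.cl_ivl_Suc)

definition gap_lp_solution :: "nat \<Rightarrow> nat \<Rightarrow> nat \<Rightarrow> real" where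
  "gap_lp_solution N i k = (if i = 2 then 1 / (2 * real N + 2) else 0)"

lemma lp_feasible_gap_lp_solution: "lp_feasible (gap_instance N) (gap_lp_solution N)"
  by (simp add: lp_feasible_def gap_lp_solution_def atLeastAtMost_1_2 field_simps
      del: sum.cl_ivl_Suc)

lemma lp_value_gap_lp_solution:
  "lp_value (gap_instance N) (gap_lp_solution N) = real N + 3 / 2"
proof -
  have "(\<Sum>k = 1..n. real k) = real n * (real n + 1) / 2" for n
    by (induction n) (simp_all add: field_simps)
  from this[of "2 * N + 2"] show ?thesis
    by (simp add: lp_value_def gap_lp_solution_def atLeastAtMost_1_2 field_simps
        flip: sum_divide_distrib del: sum.cl_ivl_Suc)
qed

text \<open>Pricing the single customer at \<open>N + 3 / 2\<close> leaves a loss of 1/2 per unit of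
  mass on product 1. Keeping this loss in the bound shows the even split optimal and also forces
  \<open>y 1 1 = 0\<close> at every optimum.\<close>

lemma lp_value_gap_instance_le_max:
  assumes "lp_feasible (gap_instance N) y"
  shows "lp_value (gap_instance N) y \<le> real N + 3 / 2 - y 1 1 / 2"
proof -
  have "(real N + 3 / 2) * (y 1 1 + (\<Sum>k = 1..2 * N + 2. y 2 k)) \<le> (real N + 3 / 2) * 1"
    using lp_feasible_gap_instanceD(2)[OF assms] by (intro mult_left_mono) auto
  with lp_value_gap_instance_le[OF assms] show ?thesis
    by (simp add: algebra_simps del: sum.cl_ivl_Suc)
qed

lemma lp_optimal_gap_lp_solution: "lp_optimal (gap_instance N) (gap_lp_solution N)"
  unfolding lp_optimal_def
  using lp_feasible_gap_lp_solution lp_value_gap_lp_solution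
    lp_value_gap_instance_le_max lp_feasible_gap_instanceD(1) by fastforce

text \<open>The rounding probabilities depend on \<open>y\<close> only through these two totals, so
  the policy can be determined for every optimal solution at once.\<close>

lemma lp_optimal_gap_instanceD:
  assumes "lp_optimal (gap_instance N) y"
  shows "y 1 1 = 0" "(\<Sum>k = 1..2 * N + 2. y 2 k) = 1"
proof -
  have feas: "lp_feasible (gap_instance N) y"
    using assms by (simp add: lp_optimal_def)
  have val: "real N + 3 / 2 \<le> lp_value (gap_instance N) y"
    using assms lp_feasible_gap_lp_solution[of N] lp_value_gap_lp_solution[of N]
    by (metis lp_optimal_def)
  show y1: "y 1 1 = 0"
    using val lp_value_gap_instance_le_max[OF feas] lp_feasible_gap_instanceD(1)[OF feas] by simp
  \<comment> \<open>With no mass on product 1, the optimal value is reached only if product 2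
    absorbs the whole customer.\<close>
  have "(real N + 3 / 2) * 1 \<le> (real N + 3 / 2) * (\<Sum>k = 1..2 * N + 2. y 2 k)"
    using order_trans[OF val lp_value_gap_instance_le[OF feas]] unfolding y1
    by (simp only: mult_zero_right add_0_left mult_1_right)
  hence "1 \<le> (\<Sum>k = 1..2 * N + 2. y 2 k)"
    by (rule mult_left_le_imp_le) simp
  with lp_feasible_gap_instanceD(2)[OF feas] y1 show "(\<Sum>k = 1..2 * N + 2. y 2 k) = 1"
    by simp
qed

lemma rounding_pmf_gap_instance:
  assumes "lp_optimal (gap_instance N) y"
  shows "rounding_pmf (gap_instance N) y = return_pmf (Some 2)"
proof (rule pmf_eqI)
  fix d
  have "lp_feasible (gap_instance N) y"
    using assms by (simp add: lp_optimal_def)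
  moreover have "rounding_prob (gap_instance N) y 1 = 0" "rounding_prob (gap_instance N) y 2 = 1"
    using lp_optimal_gap_instanceD[OF assms]
    by (simp_all add: rounding_prob_def del: sum.cl_ivl_Suc)
  ultimately show "pmf (rounding_pmf (gap_instance N) y) d = pmf (return_pmf (Some 2)) d"
    by (auto simp: pmf_rounding_pmf valid_gap_instance rounding_mass_def atLeastAtMost_1_2
        indicator_def split: option.splits)
qed

text \<open>With one period and a certain arrival, only the decision at the empty history matters,
  and the one sale earns the bonus \<open>f 1 = 1\<close>.\<close>

lemma expected_reward_gap_instance:
  assumes "\<pi> [] = return_pmf (Some i)" "i \<in> {1, 2}"
  shows "expected_reward (gap_instance N) (return_pmf \<pi>) = base_reward (gap_instance N) i + 1"
proof -
  have "bernoulli_pmf 1 = return_pmf True"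
    by (rule pmf_eqI) (simp add: indicator_def)
  hence "trajectory (gap_instance N) \<pi> 1 = return_pmf [(True, Some i)]"
    using assms by (simp add: bind_return_pmf)
  with assms(2) show ?thesis
    by (auto simp: expected_reward_def bind_return_pmf reward_def atLeastAtMost_1_2 sales_def)
qed

lemma opt_online_gap_instance_ge: "real N + 1 \<le> opt_online (gap_instance N)"
proof -
  \<comment> \<open>Feasibility ranges over all histories, even those that never occur, so the
    policy must reject once product 1 is sold out.\<close>
  define \<pi> :: policy where "\<pi> h = return_pmf (if sales h 1 < 1 then Some 1 else None)" for h
  have "\<pi> [] = return_pmf (Some 1)"
    by (simp add: \<pi>_def sales_def)
  hence "expected_reward (gap_instance N) (return_pmf \<pi>) = real N + 1"
    by (simp add: expected_reward_gap_instance)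
  moreover have "online_algorithm (gap_instance N) (return_pmf \<pi>)"
    by (simp add: online_algorithm_def feasible_policy_def \<pi>_def)
  ultimately show ?thesis
    unfolding opt_online_def
    by (metis cSUP_upper mem_Collect_eq opt_online_wf(2) valid_gap_instance)
qed

theorem proposition5:
  fixes c :: real
  assumes "c > 0"
  shows "\<exists>(I :: alloc) (f :: nat \<Rightarrow> real).
           valid_instance I \<and>
           (\<forall>i\<in>{1..products I}. bonus I i = f \<and> discrete_concave_upto (capacity I i) f) \<and>
           (\<exists>y. lp_optimal I y) \<and>
           (\<forall>y. lp_optimal I y \<longrightarrow>
              expected_reward I (return_pmf (lp_rounding_policy I y)) < c * opt_online I)"
proof -
  \<comment> \<open>The rounding policy earns exactly 1 and the optimum at least
    \<open>N + 1\<close>, so \<open>N\<close> has to make \<open>c * (N + 1)\<close> exceed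
    1.\<close>
  obtain N where "1 / c < real N"
    using reals_Archimedean2 by blast
  hence "1 < c * (real N + 1)"
    using assms by (simp add: field_simps)
  also have "\<dots> \<le> c * opt_online (gap_instance N)"
    using assms opt_online_gap_instance_ge by (intro mult_left_mono) auto
  finally have opt: "1 < c * opt_online (gap_instance N)" .
  have "expected_reward (gap_instance N) (return_pmf (lp_rounding_policy (gap_instance N) y))
      < c * opt_online (gap_instance N)" if "lp_optimal (gap_instance N) y" for y
  proof -
    have "lp_rounding_policy (gap_instance N) y [] = return_pmf (Some 2)"
      using rounding_pmf_gap_instance[OF that] by (simp add: lp_rounding_policy_def sales_def)
    with opt show ?thesis
      by (simp add: expected_reward_gap_instance)
  qed
  moreover have "discrete_concave_upto n real" for n
    by (auto simp: discrete_concave_upto_def)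
  moreover have "\<exists>y. lp_optimal (gap_instance N) y"
    using lp_optimal_gap_lp_solution by blast
  ultimately show ?thesis
    using valid_gap_instance by (intro exI[of _ "gap_instance N"] exI[of _ real]) simp
qed

end
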